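(* Let $R$ be a ring. Then $\mathrm{max.Den}^s_l(R)=\{T_l(R)\}$, where $T_l(R):=\bigcup_{S\in\mathrm{Den}^s_l(R)}S$.
   Context: Rings are associative with $1$ and nonzero. A multiplicative subset $S$ of $R$ is a submonoid of $(R,\cdot)$ with $1\in S$, $0\notin S$. It is a left Ore set if $Sr\cap Rs\neq\emptyset$ for all $r\in R$, $s\in S$; then $\mathrm{ass}(S):=\{r\in R\mid sr=0 \text{ for some } s\in S\}$ is an ideal. A left Ore set $S$ is a left denominator set if $rs=0$ with $r\in R$, $s\in S$ implies $r\in\mathrm{ass}(S)$. $\mathrm{Den}_l(R)$ is the set of left denominator sets of $R$, and $\mathrm{max.Den}_l(R)$ is the (non-empty) set of elements of $\mathrm{Den}_l(R)$ maximal under inclusion. $\mathcal{L}^s_l(R):=\bigcap_{S\in \mathrm{max.Den}_l(R)}S$. $\mathrm{Den}^s_l(R):=\{T\in\mathrm{Den}_l(R)\mid T\subseteq\mathcal{L}^s_l(R)\}$, and $\mathrm{max.Den}^s_l(R)$ is the set of maximal elements of the poset $(\mathrm{Den}^s_l(R),\subseteq)$. *)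

theory Defs imports Main begin

text \<open>Rings are the types of class \<^class>\<open>ring_1\<close>: associative, with \<open>1\<close>, and \<open>0 \<noteq> 1\<close>; commutativity
  is not assumed. The ring \<open>R\<close> is the type \<open>'a\<close>, so \<open>R\<close> itself is \<^term>\<open>UNIV :: 'a set\<close>.\<close>

definition multiplicative_subset :: "'a::ring_1 set \<Rightarrow> bool" where
  "multiplicative_subset S \<longleftrightarrow> 1 \<in> S \<and> 0 \<notin> S \<and> (\<forall>s\<in>S. \<forall>t\<in>S. s * t \<in> S)"

definition left_Ore_set :: "'a::ring_1 set \<Rightarrow> bool" where
  "left_Ore_set S \<longleftrightarrow> multiplicative_subset S \<and>
     (\<forall>r. \<forall>s\<in>S. (\<lambda>t. t * r) ` S \<inter> range (\<lambda>a. a * s) \<noteq> {})"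

definition ass :: "'a::ring_1 set \<Rightarrow> 'a set" where
  "ass S = {r. \<exists>s\<in>S. s * r = 0}"

definition left_denominator_set :: "'a::ring_1 set \<Rightarrow> bool" where
  "left_denominator_set S \<longleftrightarrow> left_Ore_set S \<and> (\<forall>r. \<forall>s\<in>S. r * s = 0 \<longrightarrow> r \<in> ass S)"

definition Den_l :: "'a::ring_1 set set" where
  "Den_l = {S. left_denominator_set S}"

definition maximal_members :: "'b set set \<Rightarrow> 'b set set" where
  "maximal_members \<A> = {S \<in> \<A>. \<forall>T\<in>\<A>. S \<subseteq> T \<longrightarrow> T = S}"

definition max_Den_l :: "'a::ring_1 set set" where
  "max_Den_l = maximal_members Den_l"

definition L_s_l :: "'a::ring_1 set" where
  "L_s_l = \<Inter> max_Den_l"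

definition Den_s_l :: "'a::ring_1 set set" where
  "Den_s_l = {T \<in> Den_l. T \<subseteq> L_s_l}"

definition max_Den_s_l :: "'a::ring_1 set set" where
  "max_Den_s_l = maximal_members Den_s_l"

definition T_l :: "'a::ring_1 set" where
  "T_l = \<Union> Den_s_l"

end

theory Submission imports Defs begin

text \<open>
  The submonoid generated by any family of left denominator sets is again a left denominator set
  as soon as it omits \<open>0\<close>: both the Ore condition and the denominator condition pass from the
  generators to products one factor at a time. For a chain the generated submonoid is essentially
  the union, so Zorn's lemma provides a maximal left denominator set. Such a set contains every
  member of \<open>Den_s_l\<close>, hence the submonoid they generate; that submonoid therefore omits \<open>0\<close>,
  lies in \<open>Den_s_l\<close>, and is its largest element.
\<close>

text \<open>Words are built by adding one generator on the left, so rule induction peels off the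
  leftmost factor; closure under arbitrary products is derived from this.\<close>

inductive_set submonoid_generated :: "'a::monoid_mult set \<Rightarrow> 'a set" for A where
  one: "1 \<in> submonoid_generated A"
| mult_left: "a \<in> A \<Longrightarrow> x \<in> submonoid_generated A \<Longrightarrow> a * x \<in> submonoid_generated A"

lemma submonoid_generated_incl: "A \<subseteq> submonoid_generated A"
  using submonoid_generated.mult_left[OF _ submonoid_generated.one, of _ A] by auto

lemma submonoid_generated_mult:
  "x \<in> submonoid_generated A \<Longrightarrow> y \<in> submonoid_generated A \<Longrightarrow> x * y \<in> submonoid_generated A"
  by (induction rule: submonoid_generated.induct)
    (auto simp: mult.assoc intro: submonoid_generated.mult_left)

lemma submonoid_generated_least:
  assumes "A \<subseteq> S" "1 \<in> S" "\<And>x y. x \<in> S \<Longrightarrow> y \<in> S \<Longrightarrow> x * y \<in> S"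
  shows "submonoid_generated A \<subseteq> S"
proof
  show "x \<in> S" if "x \<in> submonoid_generated A" for x
    using that by induction (use assms in auto)
qed

lemma Den_l_iff:
  "S \<in> Den_l \<longleftrightarrow> multiplicative_subset S \<and>
     (\<forall>r. \<forall>s\<in>S. \<exists>t\<in>S. \<exists>a. t * r = a * s) \<and>
     (\<forall>r. \<forall>s\<in>S. r * s = 0 \<longrightarrow> (\<exists>t\<in>S. t * r = 0))"
proof -
  have "(\<lambda>t. t * r) ` S \<inter> range (\<lambda>a. a * s) \<noteq> {} \<longleftrightarrow> (\<exists>t\<in>S. \<exists>a. t * r = a * s)" for r s
    by blast
  then show ?thesis
    by (simp add: Den_l_def left_denominator_set_def left_Ore_set_def ass_def)
qed

lemma Den_l_multD:
  assumes "S \<in> Den_l"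
  shows "1 \<in> S" "0 \<notin> S" "\<And>x y. x \<in> S \<Longrightarrow> y \<in> S \<Longrightarrow> x * y \<in> S"
  using assms by (auto simp: Den_l_iff multiplicative_subset_def)

lemma submonoid_generated_Union_in_Den_l:
  fixes \<F> :: "'a::ring_1 set set"
  assumes Den: "\<F> \<subseteq> Den_l" and zero: "0 \<notin> submonoid_generated (\<Union>\<F>)"
  shows "submonoid_generated (\<Union>\<F>) \<in> Den_l"
proof -
  let ?M = "submonoid_generated (\<Union>\<F>)"
  have "\<exists>t\<in>?M. \<exists>b. t * r = b * s" if "s \<in> ?M" for r s
    using that
  proof (induction arbitrary: r)
    case one
    then show ?case using submonoid_generated.one by force
  next
    case (mult_left g s)
    obtain t b where t: "t \<in> ?M" "t * r = b * s" using mult_left.IH by blast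
    \<comment> \<open>The Ore condition for the generator \<open>g\<close> is applied to the
      coefficient \<open>b\<close> rather than to \<open>r\<close>. The denominator \<open>u\<close>
      comes from the same member of \<open>\<F>\<close> as \<open>g\<close>, so it is again a
      generator.\<close>
    obtain u c where u: "u \<in> \<Union>\<F>" "u * b = c * g"
      using mult_left.hyps(1) Den unfolding Den_l_iff subset_iff by blast
    have "(u * t) * r = c * (g * s)" using t(2) u(2) by (metis mult.assoc)
    then show ?case using submonoid_generated.mult_left[OF u(1) t(1)] by blast
  qed
  moreover have "\<exists>t\<in>?M. t * r = 0" if "s \<in> ?M" "r * s = 0" for r s
    using that
  proof (induction arbitrary: r)
    case one
    then show ?case using submonoid_generated.one by force
  next
    case (mult_left g s)
    \<comment> \<open>Since \<open>r * (g * s) = (r * g) * s\<close>, the induction hypothesis at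
      \<open>r * g\<close> removes \<open>s\<close>; the denominator condition for \<open>g\<close>,
      applied to \<open>t * r\<close>, then removes \<open>g\<close>.\<close>
    obtain t where t: "t \<in> ?M" "(t * r) * g = 0"
      using mult_left.IH[of "r * g"] mult_left.prems by (auto simp: mult.assoc)
    obtain u where u: "u \<in> \<Union>\<F>" "u * (t * r) = 0"
      using t(2) mult_left.hyps(1) Den unfolding Den_l_iff subset_iff by blast
    show ?case
      using submonoid_generated.mult_left[OF u(1) t(1)] u(2) by (metis mult.assoc)
  qed
  ultimately show ?thesis
    using zero submonoid_generated.one submonoid_generated_mult
    unfolding Den_l_iff multiplicative_subset_def by blast
qed

lemma max_Den_l_nonempty: "(max_Den_l :: 'a::ring_1 set set) \<noteq> {}"
proof -
  have "\<exists>U\<in>Den_l. \<forall>X\<in>\<C>. X \<subseteq> U" if "subset.chain Den_l \<C>" for \<C> :: "'a set set"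
  proof
    have Den: "\<C> \<subseteq> Den_l" and chain: "\<And>S T. S \<in> \<C> \<Longrightarrow> T \<in> \<C> \<Longrightarrow> S \<subseteq> T \<or> T \<subseteq> S"
      using that by (auto simp: subset_chain_def)
    have "x * y \<in> \<Union>\<C>" if xy: "x \<in> \<Union>\<C>" "y \<in> \<Union>\<C>" for x y
    proof -
      obtain S where S: "S \<in> \<C>" "x \<in> S" "y \<in> S" using xy chain by blast
      then have "x * y \<in> S" using Den Den_l_multD(3) by auto
      with S(1) show ?thesis by blast
    qed
    \<comment> \<open>Inserting \<open>1\<close> covers the empty chain, whose union is empty and
      generates the trivial submonoid.\<close>
    then have "submonoid_generated (\<Union>\<C>) \<subseteq> insert 1 (\<Union>\<C>)"
      by (intro submonoid_generated_least) auto
    moreover have "0 \<notin> insert 1 (\<Union>\<C>)"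
      using Den by (auto dest: Den_l_multD(2))
    ultimately have "0 \<notin> submonoid_generated (\<Union>\<C>)" by blast
    then show "submonoid_generated (\<Union>\<C>) \<in> Den_l"
      using Den by (rule submonoid_generated_Union_in_Den_l[rotated])
    show "\<forall>X\<in>\<C>. X \<subseteq> submonoid_generated (\<Union>\<C>)"
      using submonoid_generated_incl by blast
  qed
  then obtain M :: "'a set" where "M \<in> Den_l" "\<forall>X\<in>Den_l. M \<subseteq> X \<longrightarrow> X = M"
    using subset_Zorn[of Den_l] by metis
  then show ?thesis by (auto simp: max_Den_l_def maximal_members_def)
qed

lemma T_l_in_Den_s_l: "(T_l :: 'a::ring_1 set) \<in> Den_s_l"
proof -
  let ?M = "submonoid_generated (T_l :: 'a set)"
  have sub: "?M \<subseteq> S" if "S \<in> max_Den_l" for S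
  proof (rule submonoid_generated_least)
    have "S \<in> Den_l" using that by (simp add: max_Den_l_def maximal_members_def)
    then show "1 \<in> S" "\<And>x y. x \<in> S \<Longrightarrow> y \<in> S \<Longrightarrow> x * y \<in> S" by (auto dest: Den_l_multD)
    show "T_l \<subseteq> S" using that by (auto simp: T_l_def Den_s_l_def L_s_l_def)
  qed
  \<comment> \<open>Non-emptiness of \<open>max_Den_l\<close> enters here: a single maximal set
    contains \<open>?M\<close> and omits \<open>0\<close>.\<close>
  then have "0 \<notin> ?M"
    using max_Den_l_nonempty Den_l_multD(2) unfolding max_Den_l_def maximal_members_def by blast
  then have "?M \<in> Den_l"
    unfolding T_l_def by (intro submonoid_generated_Union_in_Den_l) (auto simp: Den_s_l_def)
  then have M: "?M \<in> Den_s_l" using sub by (auto simp: Den_s_l_def L_s_l_def)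
  \<comment> \<open>As a member of \<open>Den_s_l\<close>, \<open>?M\<close> is itself one of the
    sets united in \<open>T_l\<close>.\<close>
  then have "?M = T_l" using submonoid_generated_incl[of T_l] by (auto simp: T_l_def)
  with M show ?thesis by simp
qed

theorem proposition2p8:
  "(max_Den_s_l :: 'a::ring_1 set set) = {T_l}"
proof -
  have le: "S \<subseteq> T_l" if "S \<in> Den_s_l" for S :: "'a set" using that by (auto simp: T_l_def)
  \<comment> \<open>A largest element of a family is its only maximal one.\<close>
  have "S \<in> max_Den_s_l \<longleftrightarrow> S = T_l" for S :: "'a set"
    unfolding max_Den_s_l_def maximal_members_def
    using le T_l_in_Den_s_l by blast
  then show ?thesis by blast
qed

end
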